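(* Fix integers $L\ge 2$, $n\ge 1$ and a real number $0<\sigma<\infty$. Let $\hat u:\mathbb{R}\to\mathbb{R}$ be the random network obtained from an $L$-layer fully connected $\tanh$ network by replacing the input layer with a sinusoidal feature mapping with $n$ features: $$\boldsymbol x_2=\gamma(x)=\sin(2\pi \boldsymbol W_1x),\qquad \boldsymbol u_l=\boldsymbol W_l\boldsymbol x_l\ \ (2\le l\le L),\qquad \boldsymbol x_{l+1}=\tanh(\boldsymbol u_l)\ \ (2\le l<L),\qquad \hat u(x)=\boldsymbol u_L ,$$ where $\sin$ and $\tanh$ act entrywise, $\boldsymbol W_1\in\mathbb{R}^{n\times 1}$ has i.i.d. $\mathcal N(0,\sigma^2)$ entries, $\boldsymbol W_l\in\mathbb{R}^{n\times n}$ for $1<l<L$ has i.i.d. $\mathcal N(0,\tfrac1n)$ entries, $\boldsymbol W_L\in\mathbb{R}^{1\times n}$ has i.i.d. $\mathcal N(0,\tfrac{2}{n+1})$ entries, and $\boldsymbol W_1,\dots,\boldsymbol W_L$ are independent. Then for every $x\in\mathbb{R}$, $$\operatorname{var}\!\left(\frac{\partial\hat u}{\partial x}(x)\right)\le \frac{2n}{n+1}\,2\pi^2\sigma^2\Big[1+e^{-8\pi^2\sigma^2x^2}\big(1-16\pi^2\sigma^2x^2\big)\Big].$$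
   Context: $\mathcal N(\mu,s^2)$ denotes the normal law with mean $\mu$ and variance $s^2$. The sinusoidal feature mapping is in general $\gamma(\boldsymbol x)=\sin(2\pi(\boldsymbol W_1\boldsymbol x+\boldsymbol b_1))$, with bias $\boldsymbol b_1$ initialized to zero. The layers after the input layer are initialized by the Xavier method: the weights of a dense layer with $fan_{in}$ inputs and $fan_{out}$ outputs are i.i.d. $\mathcal N\big(0,\tfrac{2}{fan_{in}+fan_{out}}\big)$; these layers have no biases. The input and output of the network are scalar, and the variance is taken over the random initial weights. *)

theory Defs
  imports "HOL-Probability.Probability"
begin

text \<open>
  A network with \<open>L\<close> layers of width \<open>n\<close>, scalar input and scalar output. The entry in row \<open>i\<close> and
  column \<open>j\<close> (both counted from 0) of the weight matrix of layer \<open>l\<close> (counted from 1) is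
  \<open>w l i j\<close>; its shape is \<open>fan_out L n l\<close> by \<open>fan_in n l\<close>, and entries outside that shape are
  never used.
\<close>

definition fan_in :: "nat \<Rightarrow> nat \<Rightarrow> nat" where
  "fan_in n l = (if l = 1 then 1 else n)"

definition fan_out :: "nat \<Rightarrow> nat \<Rightarrow> nat \<Rightarrow> nat" where
  "fan_out L n l = (if l = L then 1 else n)"

definition weight_index :: "nat \<Rightarrow> nat \<Rightarrow> (nat \<times> nat \<times> nat) set" where
  "weight_index L n = {(l, i, j). 1 \<le> l \<and> l \<le> L \<and> i < fan_out L n l \<and> j < fan_in n l}"

text \<open>
  Standard deviations: the variances are \<open>\<sigma>\<^sup>2\<close> for the sinusoidal features and the Xavier value
  \<open>2 / (fan_in + fan_out)\<close> for the other layers, i.e. \<open>2 / (n + n)\<close> for the hidden ones.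
\<close>

definition weight_sd :: "nat \<Rightarrow> nat \<Rightarrow> real \<Rightarrow> nat \<Rightarrow> real" where
  "weight_sd L n \<sigma> l =
     (if l = 1 then \<sigma> else if l < L then sqrt (1 / real n) else sqrt (2 / (real n + 1)))"

definition dense :: "nat \<Rightarrow> (nat \<Rightarrow> nat \<Rightarrow> real) \<Rightarrow> (nat \<Rightarrow> real) \<Rightarrow> nat \<Rightarrow> real" where
  "dense m A v i = (\<Sum>j<m. A i j * v j)"

definition activation :: "nat \<Rightarrow> real \<Rightarrow> real" where
  "activation l z = (if l = 1 then sin (2 * pi * z) else tanh z)"

text \<open>
  \<open>layer_out n w x l\<close> is the vector leaving layer \<open>l\<close>, i.e. the input of layer \<open>l + 1\<close>;
  \<open>layer_out n w x 0\<close> is the network input \<open>x\<close>, of which only component 0 is read.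
\<close>

primrec layer_out ::
  "nat \<Rightarrow> (nat \<Rightarrow> nat \<Rightarrow> nat \<Rightarrow> real) \<Rightarrow> real \<Rightarrow> nat \<Rightarrow> nat \<Rightarrow> real" where
  "layer_out n w x 0 = (\<lambda>_. x)"
| "layer_out n w x (Suc l) =
     (\<lambda>i. activation (Suc l) (dense (fan_in n (Suc l)) (w (Suc l)) (layer_out n w x l) i))"

definition network :: "nat \<Rightarrow> nat \<Rightarrow> (nat \<Rightarrow> nat \<Rightarrow> nat \<Rightarrow> real) \<Rightarrow> real \<Rightarrow> real" where
  "network L n w x = dense (fan_in n L) (w L) (layer_out n w x (L - 1)) 0"

lemma layer_out_differentiable: "(\<lambda>x. layer_out n w x l i) differentiable (at x)"
proof (induction l arbitrary: i)
  case 0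
  then show ?case by simp
next
  case (Suc l)
  have d: "(\<lambda>x. dense (fan_in n (Suc l)) (w (Suc l)) (layer_out n w x l) i) differentiable (at x)"
    unfolding dense_def by (intro differentiable_sum differentiable_mult differentiable_const) (auto simp: Suc)
  have a: "activation k differentiable (at z)" for k z
  proof (cases "k = 1")
    case True
    have "((\<lambda>z. sin (2 * pi * z)) has_real_derivative cos (2 * pi * z) * (2 * pi)) (at z)"
      by (auto intro!: derivative_eq_intros)
    then show ?thesis
      using True by (auto simp: activation_def [abs_def] real_differentiable_def)
  next
    case False
    have "(tanh has_real_derivative 1 - tanh z ^ 2) (at z)"
      using cosh_real_nonzero by (auto intro!: derivative_eq_intros)
    then show ?thesis
      using False by (auto simp: activation_def [abs_def] real_differentiable_def)
  qed
  show ?case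
    using differentiable_compose [OF a d] by simp
qed

text \<open>So \<open>deriv (network L n w) x\<close> is a genuine derivative for all weights \<open>w\<close>.\<close>

lemma network_differentiable: "network L n w differentiable (at x)"
proof -
  have "(\<lambda>x. network L n w x) differentiable (at x)"
    unfolding network_def dense_def
    by (intro differentiable_sum differentiable_mult differentiable_const
        layer_out_differentiable) (auto simp: layer_out_differentiable)
  then show ?thesis by simp
qed

end

theory Submission imports Defs "HOL-Real_Asymp.Real_Asymp" begin

text \<open>
  By the chain rule the vectors \<open>v\<^sub>l\<close> of layer derivatives satisfy
  \<open>v\<^sub>l = activation' (u\<^sub>l) \<cdot> W\<^sub>l v\<^bsub>l-1\<^esub>\<close>, where \<open>W\<^sub>l\<close> is centred and
  independent of \<open>v\<^bsub>l-1\<^esub>\<close>. Hence the mixed terms in the second moment of a row of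
  \<open>W\<^sub>l v\<^bsub>l-1\<^esub>\<close> vanish, and since \<open>0 \<le> tanh' \<le> 1\<close>, a hidden layer with weight variance
  \<open>1 / n\<close> does not increase \<open>E \<parallel>v\<parallel>\<^sup>2\<close>; the output layer multiplies it by \<open>2 / (n + 1)\<close>.
  For the features, \<open>E (2 \<pi> w cos (2 \<pi> w x))\<^sup>2 = 2 \<pi>\<^sup>2 E (w\<^sup>2 + w\<^sup>2 cos (4 \<pi> x w))\<close>, and the last
  expectation is read off the second derivative of the Gaussian characteristic function.
\<close>

subsection \<open>The characteristic function of a centred Gaussian and its second derivative\<close>

text \<open>The absolute Gaussian moment of order \<open>k\<close>, scaled by \<open>B\<close>,
  dominates. This is applied to cosines with \<open>k = 0\<close> and \<open>k = 2\<close>.\<close>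

lemma integrable_normal_density_mult_bounded:
  fixes g :: "real \<Rightarrow> real"
  assumes "0 < \<sigma>" and [measurable]: "g \<in> borel_measurable borel" and "\<And>x. \<bar>g x\<bar> \<le> B"
  shows "integrable lborel (\<lambda>x. normal_density 0 \<sigma> x * (x ^ k * g x))"
proof (rule Bochner_Integration.integrable_bound)
  show "integrable lborel (\<lambda>x. normal_density 0 \<sigma> x * \<bar>x\<bar> ^ k * B)"
    using integrable_normal_moment_abs [OF \<open>0 < \<sigma>\<close>, of 0 k] by simp
  have "normal_density 0 \<sigma> x * \<bar>x\<bar> ^ k * \<bar>g x\<bar> \<le> normal_density 0 \<sigma> x * \<bar>x\<bar> ^ k * \<bar>B\<bar>" for x
    using assms(3) [of x] by (intro mult_left_mono) auto
  then show "AE x in lborel. norm (normal_density 0 \<sigma> x * (x ^ k * g x))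
      \<le> norm (normal_density 0 \<sigma> x * \<bar>x\<bar> ^ k * B)"
    by (simp add: abs_mult power_abs mult.assoc)
qed measurable

text \<open>Rescaling by \<open>\<sigma>\<close> reduces to the standard normal law, where the
  integral is the real part of the characteristic function at \<open>\<sigma> * t\<close>.\<close>

lemma integral_normal_density_cos:
  assumes "0 < \<sigma>"
  shows "(\<integral>x. normal_density 0 \<sigma> x * cos (t * x) \<partial>lborel) = exp (- (\<sigma> * t)\<^sup>2 / 2)"
proof -
  have "(\<integral>x. normal_density 0 \<sigma> x * cos (t * x) \<partial>lborel)
      = \<bar>\<sigma>\<bar> *\<^sub>R (\<integral>x. normal_density 0 \<sigma> (0 + \<sigma> * x) * cos (t * (0 + \<sigma> * x)) \<partial>lborel)"
    using assms by (intro lborel_integral_real_affine) auto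
  also have "\<dots> = (\<integral>x. \<sigma> * (normal_density 0 \<sigma> (\<sigma> * x) * cos (t * (\<sigma> * x))) \<partial>lborel)"
    using assms by simp
  also have "\<dots> = (\<integral>x. std_normal_density x * cos (\<sigma> * t * x) \<partial>lborel)"
    using assms
    by (intro Bochner_Integration.integral_cong)
       (auto simp: normal_density_def real_sqrt_mult power_mult_distrib field_simps)
  also have "\<dots> = (\<integral>x. cos (\<sigma> * t * x) \<partial>std_normal_distribution)"
    by (subst integral_real_density) auto
  also have "\<dots> = Re (char std_normal_distribution (\<sigma> * t))"
  proof -
    interpret real_distribution std_normal_distribution by (rule real_dist_normal_dist)
    show ?thesis
      unfolding char_def using integral_Re [OF integrable_iexp, of "\<lambda>x. \<sigma> * t * x"]
      by (simp add: Re_exp)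
  qed
  also have "\<dots> = exp (- (\<sigma> * t)\<^sup>2 / 2)"
    by (simp add: char_std_normal_distribution)
  finally show ?thesis .
qed

text \<open>Formally this is minus the second derivative in \<open>t\<close> of the preceding
  formula. Instead of differentiating under the integral, the proof integrates an exact derivative
  in \<open>x\<close> over the whole line; its vanishing expresses the moment with
  \<open>x\<^sup>2\<close> through the one without.\<close>

lemma integral_normal_density_square_cos:
  assumes "0 < \<sigma>"
  shows "(\<integral>x. normal_density 0 \<sigma> x * (x\<^sup>2 * cos (t * x)) \<partial>lborel)
    = \<sigma>\<^sup>2 * (1 - (\<sigma> * t)\<^sup>2) * exp (- (\<sigma> * t)\<^sup>2 / 2)"
proof -
  let ?\<phi> = "normal_density 0 \<sigma>"
  \<comment> \<open>\<open>F\<close> is chosen so that its derivative \<open>f\<close> contains no sine; \<open>F\<close> vanishes at both infinities.\<close>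
  define F where "F x = (\<sigma>\<^sup>2 * x * cos (t * x) - \<sigma> ^ 4 * t * sin (t * x)) * ?\<phi> x" for x
  define f where "f x = (\<sigma>\<^sup>2 - \<sigma> ^ 4 * t\<^sup>2 - x\<^sup>2) * cos (t * x) * ?\<phi> x" for x
  note nd = integrable_normal_density_mult_bounded [OF assms, where g = "\<lambda>x. cos (t * x)" and B = 1]
  have int0: "integrable lborel (\<lambda>x. ?\<phi> x * cos (t * x))"
    using nd [of 0] by simp
  have int2: "integrable lborel (\<lambda>x. ?\<phi> x * (x\<^sup>2 * cos (t * x)))"
    using nd [of 2] by simp
  have f_eq: "f x = (\<sigma>\<^sup>2 - \<sigma> ^ 4 * t\<^sup>2) * (?\<phi> x * cos (t * x)) - ?\<phi> x * (x\<^sup>2 * cos (t * x))" for x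
    by (simp add: f_def algebra_simps)
  have f_int: "integrable lborel f"
    unfolding f_eq [abs_def] using int0 int2 by (intro Bochner_Integration.integrable_diff integrable_mult_right)
  have phi': "(?\<phi> has_real_derivative - (x / \<sigma>\<^sup>2) * ?\<phi> x) (at x)" for x
    using assms unfolding normal_density_def
    by (auto intro!: derivative_eq_intros simp: field_simps power2_eq_square)
  have F': "(F has_real_derivative f x) (at x)" for x
    unfolding F_def using assms
    by (auto intro!: derivative_eq_intros phi' simp: f_def field_simps eval_nat_numeral)
  \<comment> \<open>The filter \<open>G\<close> stays arbitrary so that one squeeze, with sine and
    cosine bounded by 1, serves both \<open>at_top\<close> and \<open>at_bot\<close>.\<close>
  have lim: "(F \<longlongrightarrow> 0) G" if "((\<lambda>x. (\<sigma>\<^sup>2 * \<bar>x\<bar> + \<sigma> ^ 4 * \<bar>t\<bar>) * ?\<phi> x) \<longlongrightarrow> 0) G" for G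
  proof (rule tendsto_rabs_zero_cancel, rule tendsto_sandwich [OF _ _ tendsto_const that])
    have "\<bar>\<sigma>\<^sup>2 * x * cos (t * x) - \<sigma> ^ 4 * t * sin (t * x)\<bar> \<le> \<sigma>\<^sup>2 * \<bar>x\<bar> + \<sigma> ^ 4 * \<bar>t\<bar>" for x
    proof -
      have "\<bar>\<sigma>\<^sup>2 * x * cos (t * x)\<bar> \<le> \<sigma>\<^sup>2 * \<bar>x\<bar> * 1" "\<bar>\<sigma> ^ 4 * t * sin (t * x)\<bar> \<le> \<sigma> ^ 4 * \<bar>t\<bar> * 1"
        unfolding abs_mult by (intro mult_mono; simp)+
      then show ?thesis by linarith
    qed
    then show "\<forall>\<^sub>F x in G. \<bar>F x\<bar> \<le> (\<sigma>\<^sup>2 * \<bar>x\<bar> + \<sigma> ^ 4 * \<bar>t\<bar>) * ?\<phi> x"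
      unfolding F_def abs_mult by (auto intro!: always_eventually mult_right_mono)
  qed auto
  have lim': "(F \<longlongrightarrow> 0) G"
    if "((\<lambda>x. exp (- (x\<^sup>2 / (2 * \<sigma>\<^sup>2)))) \<longlongrightarrow> 0) G"
      "((\<lambda>x. \<bar>x\<bar> * exp (- (x\<^sup>2 / (2 * \<sigma>\<^sup>2)))) \<longlongrightarrow> 0) G" for G
  proof (rule lim)
    let ?c = "1 / sqrt (2 * pi * \<sigma>\<^sup>2)"
    have "((\<lambda>x. \<sigma>\<^sup>2 * ?c * (\<bar>x\<bar> * exp (- (x\<^sup>2 / (2 * \<sigma>\<^sup>2))))
        + \<sigma> ^ 4 * \<bar>t\<bar> * ?c * exp (- (x\<^sup>2 / (2 * \<sigma>\<^sup>2)))) \<longlongrightarrow> \<sigma>\<^sup>2 * ?c * 0 + \<sigma> ^ 4 * \<bar>t\<bar> * ?c * 0) G"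
      by (intro tendsto_intros that)
    then show "((\<lambda>x. (\<sigma>\<^sup>2 * \<bar>x\<bar> + \<sigma> ^ 4 * \<bar>t\<bar>) * ?\<phi> x) \<longlongrightarrow> 0) G"
      by (simp add: normal_density_def distrib_left distrib_right add_divide_distrib mult_ac)
  qed
  have gauss: "((\<lambda>x. exp (- (x\<^sup>2 / s))) \<longlongrightarrow> 0) at_top" "((\<lambda>x. exp (- (x\<^sup>2 / s))) \<longlongrightarrow> 0) at_bot"
    "((\<lambda>x. \<bar>x\<bar> * exp (- (x\<^sup>2 / s))) \<longlongrightarrow> 0) at_top" "((\<lambda>x. \<bar>x\<bar> * exp (- (x\<^sup>2 / s))) \<longlongrightarrow> 0) at_bot"
    if "s > 0" for s :: real
    using that by real_asymp+
  have "2 * \<sigma>\<^sup>2 > 0"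
    using assms by simp
  from lim' [OF gauss(1,3) [OF this]] lim' [OF gauss(2,4) [OF this]]
  have F_top: "(F \<longlongrightarrow> 0) at_top" and F_bot: "(F \<longlongrightarrow> 0) at_bot" .
  have "(LBINT x=-\<infinity>..\<infinity>. f x) = 0 - 0"
  proof (intro interval_integral_FTC_integrable [where F = F])
    show "set_integrable lborel (einterval (-\<infinity>) \<infinity>) f"
      using f_int by (simp add: set_integrable_def)
    show "isCont f x" for x
      using assms unfolding f_def normal_density_def by (intro continuous_intros) auto
    show "(F has_vector_derivative f x) (at x)" for x
      using F' by (simp add: has_real_derivative_iff_has_vector_derivative)
  qed (simp_all add: ereal_tendsto_simps F_top F_bot)
  then have "(\<integral>x. f x \<partial>lborel) = 0"
    by (simp add: interval_lebesgue_integral_def set_lebesgue_integral_def)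
  also have "(\<integral>x. f x \<partial>lborel) = (\<sigma>\<^sup>2 - \<sigma> ^ 4 * t\<^sup>2) * (\<integral>x. ?\<phi> x * cos (t * x) \<partial>lborel)
      - (\<integral>x. ?\<phi> x * (x\<^sup>2 * cos (t * x)) \<partial>lborel)"
    unfolding f_eq [abs_def] using int0 int2 by simp
  also have "\<sigma>\<^sup>2 - \<sigma> ^ 4 * t\<^sup>2 = \<sigma>\<^sup>2 * (1 - (\<sigma> * t)\<^sup>2)"
    by (simp add: power2_eq_square power4_eq_xxxx algebra_simps)
  finally show ?thesis
    by (simp add: integral_normal_density_cos [OF assms])
qed

subsection \<open>Linear combinations with independent random coefficients\<close>

text \<open>The sum of the squares dominates the product. No independence enters, so this covers
  products of derivatives of one layer, which share earlier weights.\<close>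

lemma integrable_mult_of_squares:
  fixes f g :: "'a \<Rightarrow> real"
  assumes [measurable]: "f \<in> borel_measurable M" "g \<in> borel_measurable M"
    and "integrable M (\<lambda>\<omega>. (f \<omega>)\<^sup>2)" "integrable M (\<lambda>\<omega>. (g \<omega>)\<^sup>2)"
  shows "integrable M (\<lambda>\<omega>. f \<omega> * g \<omega>)"
proof (rule Bochner_Integration.integrable_bound)
  show "integrable M (\<lambda>\<omega>. (f \<omega>)\<^sup>2 + (g \<omega>)\<^sup>2)"
    using assms by simp
  have "\<bar>a * b\<bar> \<le> \<bar>a\<^sup>2 + b\<^sup>2\<bar>" for a b :: real
  proof -
    have "0 \<le> \<bar>a\<bar> * \<bar>b\<bar>" by simp
    with sum_squares_bound [of "\<bar>a\<bar>" "\<bar>b\<bar>"] have "\<bar>a\<bar> * \<bar>b\<bar> \<le> a\<^sup>2 + b\<^sup>2"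
      by (simp only: power2_abs)
    then show ?thesis by (simp add: abs_mult)
  qed
  then show "AE \<omega> in M. norm (f \<omega> * g \<omega>) \<le> norm ((f \<omega>)\<^sup>2 + (g \<omega>)\<^sup>2)"
    by simp
qed measurable

section \<open>Sigma-algebras of blocks of random variables and their independence\<close>

text \<open>Pulling back the product sigma-algebra along the restricted vector matches
  \<open>indep_var_restrict\<close>, which speaks of exactly these vectors.\<close>

definition generated_by :: "'a measure \<Rightarrow> ('i \<Rightarrow> 'a \<Rightarrow> real) \<Rightarrow> 'i set \<Rightarrow> 'a measure" where
  "generated_by M X A = vimage_algebra (space M) (\<lambda>\<omega>. \<lambda>a\<in>A. X a \<omega>) (Pi\<^sub>M A (\<lambda>_. borel))"

lemma space_generated_by [simp]: "space (generated_by M X A) = space M"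
  by (simp add: generated_by_def)

lemma measurable_generated_by:
  assumes "a \<in> A"
  shows "X a \<in> borel_measurable (generated_by M X A)"
proof -
  have "(\<lambda>\<omega>. \<lambda>a\<in>A. X a \<omega>) \<in> generated_by M X A \<rightarrow>\<^sub>M Pi\<^sub>M A (\<lambda>_. borel)"
    unfolding generated_by_def by (rule measurable_vimage_algebra1) (auto simp: space_PiM)
  from measurable_compose [OF this measurable_component_singleton [OF assms]] show ?thesis
    using assms by simp
qed

text \<open>Minimality of the generated sigma-algebra: the identity from \<open>N\<close> to it is
  measurable. With \<open>N\<close> a larger block this gives monotonicity, with
  \<open>N = M\<close> it gives random variables.\<close>

lemma measurable_of_generated_by:
  assumes "\<And>a. a \<in> A \<Longrightarrow> X a \<in> borel_measurable N" "space N = space M"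
    and "V \<in> borel_measurable (generated_by M X A)"
  shows "V \<in> borel_measurable N"
proof -
  have "(\<lambda>\<omega>. \<omega>) \<in> N \<rightarrow>\<^sub>M generated_by M X A"
    unfolding generated_by_def
  proof (rule measurable_vimage_algebra2)
    show "(\<lambda>\<omega>. \<lambda>a\<in>A. X a \<omega>) \<in> N \<rightarrow>\<^sub>M Pi\<^sub>M A (\<lambda>_. borel)"
      using assms(1) by (rule measurable_restrict)
  qed (simp add: assms(2))
  from measurable_compose [OF this assms(3)] show ?thesis by simp
qed

lemma generated_by_mono:
  assumes "A \<subseteq> B" "V \<in> borel_measurable (generated_by M X A)"
  shows "V \<in> borel_measurable (generated_by M X B)"
proof (rule measurable_of_generated_by [OF _ _ assms(2)])
  show "X a \<in> borel_measurable (generated_by M X B)" if "a \<in> A" for a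
    using that assms(1) by (intro measurable_generated_by) auto
qed simp

context prob_space
begin

text \<open>Disjoint blocks of an independent family generate independent sigma-algebras, and
  independence is inherited by the smaller sigma-algebras of \<open>U\<close> and
  \<open>V\<close>.\<close>

lemma indep_var_generated_by:
  fixes U V :: "'a \<Rightarrow> real"
  assumes indep: "indep_vars (\<lambda>_. borel) X I" and "A \<subseteq> I" "B \<subseteq> I" "A \<inter> B = {}"
    and U: "U \<in> borel_measurable (generated_by M X A)"
    and V: "V \<in> borel_measurable (generated_by M X B)"
  shows "indep_var borel U borel V"
proof -
  have sets_eq: "sigma_sets (space M) {(\<lambda>\<omega>. \<lambda>a\<in>C. X a \<omega>) -` S \<inter> space M |S. S \<in> sets (Pi\<^sub>M C (\<lambda>_. borel))}
      = sets (generated_by M X C)" for C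
    unfolding generated_by_def sets_vimage_algebra ..
  have ind: "indep_set (sets (generated_by M X A)) (sets (generated_by M X B))"
    using indep_var_restrict [OF indep \<open>A \<inter> B = {}\<close> \<open>A \<subseteq> I\<close> \<open>B \<subseteq> I\<close>]
    unfolding indep_var_eq sets_eq by simp
  have sub: "sigma_sets (space M) {Z -` S \<inter> space M |S. S \<in> sets borel} \<subseteq> sets (generated_by M X C)"
    if "Z \<in> borel_measurable (generated_by M X C)" for Z :: "'a \<Rightarrow> real" and C
    using measurable_sets [OF that]
    by (intro sets.sigma_sets_subset [of _ "generated_by M X C", simplified]) auto
  have rv: "random_variable borel Z"
    if "C \<subseteq> I" "Z \<in> borel_measurable (generated_by M X C)" for Z :: "'a \<Rightarrow> real" and C
    using that indep by (intro measurable_of_generated_by [OF _ refl that(2)]) (auto simp: indep_vars_def2)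
  have "indep_set (sigma_sets (space M) {U -` S \<inter> space M |S. S \<in> sets borel})
      (sigma_sets (space M) {V -` S \<inter> space M |S. S \<in> sets borel})"
    using ind unfolding indep_set_def
    by (rule indep_sets_mono_sets) (simp add: sub [OF U] sub [OF V] split: bool.split)
  then show ?thesis
    unfolding indep_var_eq using rv [OF \<open>A \<subseteq> I\<close> U] rv [OF \<open>B \<subseteq> I\<close> V] by blast
qed

section \<open>Moments of a linear combination whose coefficients are independent of the
  vector\<close>

text \<open>In the expanded square, the independent centred coefficients remove every term with
  \<open>j \<noteq> k\<close>, however the \<open>V j\<close> depend on one another. The map
  \<open>e\<close> embeds the summation index into the index set of the whole family.\<close>

lemma
  fixes X :: "'i \<Rightarrow> 'a \<Rightarrow> real" and V :: "'j \<Rightarrow> 'a \<Rightarrow> real"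
  assumes indep: "indep_vars (\<lambda>_. borel) X I"
    and "finite J" "inj_on e J" "e ` J \<subseteq> I" "A \<subseteq> I" "e ` J \<inter> A = {}"
    and X_sq: "\<And>j. j \<in> J \<Longrightarrow> integrable M (\<lambda>\<omega>. (X (e j) \<omega>)\<^sup>2)"
    and X_mean: "\<And>j. j \<in> J \<Longrightarrow> expectation (X (e j)) = 0"
    and X_var: "\<And>j. j \<in> J \<Longrightarrow> expectation (\<lambda>\<omega>. (X (e j) \<omega>)\<^sup>2) = c"
    and V_meas: "\<And>j. j \<in> J \<Longrightarrow> V j \<in> borel_measurable (generated_by M X A)"
    and V_sq: "\<And>j. j \<in> J \<Longrightarrow> integrable M (\<lambda>\<omega>. (V j \<omega>)\<^sup>2)"
  shows integrable_indep_combination: "integrable M (\<lambda>\<omega>. \<Sum>j\<in>J. X (e j) \<omega> * V j \<omega>)"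
    and expectation_indep_combination: "expectation (\<lambda>\<omega>. \<Sum>j\<in>J. X (e j) \<omega> * V j \<omega>) = 0"
    and integrable_indep_combination_sq: "integrable M (\<lambda>\<omega>. (\<Sum>j\<in>J. X (e j) \<omega> * V j \<omega>)\<^sup>2)"
    and expectation_indep_combination_sq: "expectation (\<lambda>\<omega>. (\<Sum>j\<in>J. X (e j) \<omega> * V j \<omega>)\<^sup>2)
      = c * (\<Sum>j\<in>J. expectation (\<lambda>\<omega>. (V j \<omega>)\<^sup>2))"
proof -
  have X_gen: "X (e j) \<in> borel_measurable (generated_by M X (e ` J))" if "j \<in> J" for j
    using that by (intro measurable_generated_by) auto
  have X_rv: "X (e j) \<in> borel_measurable M" if "j \<in> J" for j
    using indep that \<open>e ` J \<subseteq> I\<close> by (auto simp: indep_vars_def2)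
  have X_int: "integrable M (X (e j))" if "j \<in> J" for j
    by (rule square_integrable_imp_integrable [OF X_rv X_sq, OF that that])
  have V_rv: "V j \<in> borel_measurable M" if "j \<in> J" for j
    using indep_var_generated_by [OF indep assms(4-6) X_gen V_meas, OF that that]
    by (rule indep_var_rv2)
  have V_int: "integrable M (V j)" if "j \<in> J" for j
    by (rule square_integrable_imp_integrable [OF V_rv V_sq, OF that that])
  have XX_int: "integrable M (\<lambda>\<omega>. X (e j) \<omega> * X (e k) \<omega>)" if "j \<in> J" "k \<in> J" for j k
    by (rule integrable_mult_of_squares [OF X_rv X_rv X_sq X_sq, OF that that])
  have XX: "expectation (\<lambda>\<omega>. X (e j) \<omega> * X (e k) \<omega>) = (if j = k then c else 0)"
    if "j \<in> J" "k \<in> J" for j k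
  proof (cases "j = k")
    case True
    then show ?thesis using X_var [OF that(1)] by (simp add: power2_eq_square)
  next
    case False
    \<comment> \<open>Two coefficients are separated as singleton blocks, disjoint by injectivity of
      \<open>e\<close>.\<close>
    have "indep_var borel (X (e j)) borel (X (e k))"
    proof (rule indep_var_generated_by [OF indep, of "{e j}" "{e k}"])
      show "{e j} \<inter> {e k} = {}"
        using False that \<open>inj_on e J\<close> by (auto dest: inj_onD)
    qed (use that \<open>e ` J \<subseteq> I\<close> in \<open>auto intro: measurable_generated_by\<close>)
    from indep_var_lebesgue_integral [OF this X_int X_int] show ?thesis
      using False that X_mean by simp
  qed
  have VV_int: "integrable M (\<lambda>\<omega>. V j \<omega> * V k \<omega>)" if "j \<in> J" "k \<in> J" for j k
    by (rule integrable_mult_of_squares [OF V_rv V_rv V_sq V_sq, OF that that])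
  have XV_indep: "indep_var borel (X (e j)) borel (V j)" if "j \<in> J" for j
    by (rule indep_var_generated_by [OF indep assms(4-6) X_gen V_meas, OF that that])
  have XV_int: "integrable M (\<lambda>\<omega>. X (e j) \<omega> * V j \<omega>)" if "j \<in> J" for j
    by (rule indep_var_integrable [OF XV_indep X_int V_int, OF that that that])
  show "integrable M (\<lambda>\<omega>. \<Sum>j\<in>J. X (e j) \<omega> * V j \<omega>)"
    by (intro Bochner_Integration.integrable_sum XV_int)
  show "expectation (\<lambda>\<omega>. \<Sum>j\<in>J. X (e j) \<omega> * V j \<omega>) = 0"
    using XV_int by (simp add: indep_var_lebesgue_integral [OF XV_indep X_int V_int] X_mean)
  \<comment> \<open>Grouping the two coefficients apart from the two \<open>V\<close> factors makes
    each group depend on one block, so the expectation of the product factorises.\<close>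
  let ?T = "\<lambda>j k \<omega>. (X (e j) \<omega> * X (e k) \<omega>) * (V j \<omega> * V k \<omega>)"
  have T_indep: "indep_var borel (\<lambda>\<omega>. X (e j) \<omega> * X (e k) \<omega>) borel (\<lambda>\<omega>. V j \<omega> * V k \<omega>)"
    if "j \<in> J" "k \<in> J" for j k
    by (rule indep_var_generated_by [OF indep assms(4-6)])
       (use that in \<open>auto intro!: borel_measurable_times X_gen V_meas\<close>)
  have T_int: "integrable M (?T j k)" if "j \<in> J" "k \<in> J" for j k
    by (rule indep_var_integrable [OF T_indep XX_int VV_int, OF that that that])
  have T_eq: "expectation (?T j k) = (if j = k then c * expectation (\<lambda>\<omega>. (V j \<omega>)\<^sup>2) else 0)"
    if "j \<in> J" "k \<in> J" for j k
    using that by (simp add: indep_var_lebesgue_integral [OF T_indep XX_int VV_int] XX power2_eq_square)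
  have sq: "(\<Sum>j\<in>J. X (e j) \<omega> * V j \<omega>)\<^sup>2 = (\<Sum>j\<in>J. \<Sum>k\<in>J. ?T j k \<omega>)" for \<omega>
    by (simp add: power2_eq_square sum_product mult_ac)
  show "integrable M (\<lambda>\<omega>. (\<Sum>j\<in>J. X (e j) \<omega> * V j \<omega>)\<^sup>2)"
    unfolding sq by (intro Bochner_Integration.integrable_sum T_int)
  have "expectation (\<lambda>\<omega>. (\<Sum>j\<in>J. X (e j) \<omega> * V j \<omega>)\<^sup>2) = (\<Sum>j\<in>J. \<Sum>k\<in>J. expectation (?T j k))"
    unfolding sq using T_int by (simp add: Bochner_Integration.integrable_sum)
  also have "\<dots> = (\<Sum>j\<in>J. c * expectation (\<lambda>\<omega>. (V j \<omega>)\<^sup>2))"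
    using \<open>finite J\<close> by (simp add: T_eq)
  finally show "expectation (\<lambda>\<omega>. (\<Sum>j\<in>J. X (e j) \<omega> * V j \<omega>)\<^sup>2)
      = c * (\<Sum>j\<in>J. expectation (\<lambda>\<omega>. (V j \<omega>)\<^sup>2))"
    by (simp add: sum_distrib_left)
qed

end

subsection \<open>The derivative of the network in its input\<close>

definition activation_deriv :: "nat \<Rightarrow> real \<Rightarrow> real" where
  "activation_deriv l z = (if l = 1 then 2 * pi * cos (2 * pi * z) else 1 - (tanh z)\<^sup>2)"

lemma has_real_derivative_activation:
  "(activation l has_real_derivative activation_deriv l z) (at z)"
proof (cases "l = 1")
  case True
  then show ?thesis
    unfolding activation_def [abs_def] activation_deriv_def
    by (auto intro!: derivative_eq_intros)
next
  case False
  then show ?thesis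
    unfolding activation_def [abs_def] activation_deriv_def
    using cosh_real_nonzero by (auto intro!: derivative_eq_intros)
qed

lemma measurable_activation [measurable]: "activation l \<in> borel_measurable borel"
  by (intro borel_measurable_continuous_onI continuous_at_imp_continuous_on ballI
      DERIV_isCont [OF has_real_derivative_activation])

lemma measurable_activation_deriv [measurable]: "activation_deriv l \<in> borel_measurable borel"
  unfolding activation_deriv_def [abs_def]
  by (cases "l = 1") (auto intro!: borel_measurable_continuous_onI continuous_intros)

lemma abs_activation_deriv_le_1:
  assumes "l \<noteq> 1"
  shows "\<bar>activation_deriv l z\<bar> \<le> 1"
  using assms tanh_real_bounds [of z]
  by (auto simp: activation_deriv_def abs_square_le_1 abs_le_iff)

text \<open>Chain rule in forward mode. The recursion keeps the weights of layer
  \<open>Suc l\<close> visible as a linear map applied to the previous derivative vector, which is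
  what the independence argument needs.\<close>

primrec layer_deriv ::
  "nat \<Rightarrow> (nat \<Rightarrow> nat \<Rightarrow> nat \<Rightarrow> real) \<Rightarrow> real \<Rightarrow> nat \<Rightarrow> nat \<Rightarrow> real" where
  "layer_deriv n w x 0 = (\<lambda>_. 1)"
| "layer_deriv n w x (Suc l) =
     (\<lambda>i. activation_deriv (Suc l) (dense (fan_in n (Suc l)) (w (Suc l)) (layer_out n w x l) i) *
       dense (fan_in n (Suc l)) (w (Suc l)) (layer_deriv n w x l) i)"

lemma has_real_derivative_dense:
  assumes "\<And>j. ((\<lambda>x. f x j) has_real_derivative f' j) (at x)"
  shows "((\<lambda>x. dense m A (f x) i) has_real_derivative dense m A f' i) (at x)"
  unfolding dense_def using assms by (intro DERIV_sum DERIV_cmult)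

lemma has_real_derivative_layer_out:
  "((\<lambda>x. layer_out n w x l i) has_real_derivative layer_deriv n w x l i) (at x)"
proof (induction l arbitrary: i)
  case 0
  then show ?case by simp
next
  case (Suc l)
  show ?case
    using DERIV_chain2 [OF has_real_derivative_activation has_real_derivative_dense [OF Suc]] by simp
qed

lemma deriv_network:
  "deriv (network L n w) x = dense (fan_in n L) (w L) (layer_deriv n w x (L - 1)) 0"
proof -
  have "network L n w = (\<lambda>x. dense (fan_in n L) (w L) (layer_out n w x (L - 1)) 0)"
    by (simp add: network_def fun_eq_iff)
  then show ?thesis
    by (auto intro!: DERIV_imp_deriv has_real_derivative_dense has_real_derivative_layer_out)
qed

subsection \<open>Propagation of the second moment through the layers\<close>

locale random_network = prob_space M for M :: "'a measure" +
  fixes W :: "nat \<Rightarrow> nat \<Rightarrow> nat \<Rightarrow> 'a \<Rightarrow> real" and L n :: nat and \<sigma> x :: real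
  assumes L: "L \<ge> 2" and n: "n \<ge> 1" and sigma: "\<sigma> > 0"
    and indep: "indep_vars (\<lambda>_. borel) (\<lambda>(l, i, j). W l i j) (weight_index L n)"
    and normal: "\<And>l i j. (l, i, j) \<in> weight_index L n \<Longrightarrow>
           distributed M lborel (W l i j) (normal_density 0 (weight_sd L n \<sigma> l))"
begin

abbreviation "out l i \<omega> \<equiv> layer_out n (\<lambda>l i j. W l i j \<omega>) x l i"
abbreviation "der l i \<omega> \<equiv> layer_deriv n (\<lambda>l i j. W l i j \<omega>) x l i"

text \<open>The sigma-algebras \<open>history l\<close> form a filtration along the layers. The
  weights of layer \<open>Suc l\<close> are not in \<open>past l\<close>, which provides the
  disjoint blocks for independence.\<close>

definition past :: "nat \<Rightarrow> (nat \<times> nat \<times> nat) set" where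
  "past l = {(k, i, j) \<in> weight_index L n. k \<le> l}"

abbreviation "history l \<equiv> generated_by M (\<lambda>(l, i, j). W l i j) (past l)"

lemma weight_sd_pos: "weight_sd L n \<sigma> l > 0"
  using sigma n by (simp add: weight_sd_def)

lemma weight_moments:
  assumes "(l, i, j) \<in> weight_index L n"
  shows "integrable M (\<lambda>\<omega>. (W l i j \<omega>)\<^sup>2)" "expectation (W l i j) = 0"
    "expectation (\<lambda>\<omega>. (W l i j \<omega>)\<^sup>2) = (weight_sd L n \<sigma> l)\<^sup>2"
proof -
  show E: "expectation (W l i j) = 0"
    using normal_distributed_expectation [OF weight_sd_pos normal [OF assms]] .
  show "integrable M (\<lambda>\<omega>. (W l i j \<omega>)\<^sup>2)"
    using distributed_integrable [OF normal [OF assms], of "\<lambda>x. x\<^sup>2"]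
      integrable_normal_moment [OF weight_sd_pos, of 0 l 2] by simp
  show "expectation (\<lambda>\<omega>. (W l i j \<omega>)\<^sup>2) = (weight_sd L n \<sigma> l)\<^sup>2"
    using normal_distributed_variance [OF weight_sd_pos normal [OF assms]] E by simp
qed

lemma weight_history:
  assumes "1 \<le> l" "l < L" "i < n" "j < fan_in n l"
  shows "W l i j \<in> borel_measurable (history l)"
  using measurable_generated_by [of "(l, i, j)" "past l" "\<lambda>(l, i, j). W l i j" M] assms
  by (auto simp: past_def weight_index_def fan_out_def)

lemma history_mono:
  assumes "V \<in> borel_measurable (history l)"
  shows "V \<in> borel_measurable (history (Suc l))"
  using assms by (rule generated_by_mono [rotated]) (auto simp: past_def)

text \<open>Outputs and derivatives go through one induction because the slope in
  \<open>der (Suc l)\<close> is evaluated at a combination of \<open>out l\<close>. The vector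
  leaving layer \<open>l\<close> has \<open>fan_in n (Suc l)\<close> components; beyond these,
  weights outside the prescribed shape would enter.\<close>

lemma measurable_layer:
  assumes "l < L" "i < fan_in n (Suc l)"
  shows "out l i \<in> borel_measurable (history l) \<and> der l i \<in> borel_measurable (history l)"
  using assms
proof (induction l arbitrary: i)
  case 0
  then show ?case by simp
next
  case (Suc l)
  have i: "i < n" using Suc.prems by (simp add: fan_in_def)
  have [measurable]: "W (Suc l) i j \<in> borel_measurable (history (Suc l))" if "j < fan_in n (Suc l)" for j
    using that Suc.prems i by (intro weight_history) auto
  have [measurable]: "out l j \<in> borel_measurable (history (Suc l))"
    "der l j \<in> borel_measurable (history (Suc l))" if "j < fan_in n (Suc l)" for j
    using that Suc.prems Suc.IH [of j] by (auto intro: history_mono)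
  have [measurable]:
    "(\<lambda>\<omega>. dense (fan_in n (Suc l)) (\<lambda>i j. W (Suc l) i j \<omega>) (\<lambda>j. out l j \<omega>) i) \<in> borel_measurable (history (Suc l))"
    "(\<lambda>\<omega>. dense (fan_in n (Suc l)) (\<lambda>i j. W (Suc l) i j \<omega>) (\<lambda>j. der l j \<omega>) i) \<in> borel_measurable (history (Suc l))"
    unfolding dense_def by (intro borel_measurable_sum borel_measurable_times; simp)+
  show ?case by simp
qed

section \<open>Exact second moment of the feature derivatives\<close>

definition feature_moment :: real where
  "feature_moment = 2 * pi\<^sup>2 * \<sigma>\<^sup>2 *
     (1 + exp (- 8 * pi\<^sup>2 * \<sigma>\<^sup>2 * x\<^sup>2) * (1 - 16 * pi\<^sup>2 * \<sigma>\<^sup>2 * x\<^sup>2))"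

lemma first_layer_moment:
  assumes "i < n"
  shows "integrable M (\<lambda>\<omega>. (der 1 i \<omega>)\<^sup>2)" "expectation (\<lambda>\<omega>. (der 1 i \<omega>)\<^sup>2) = feature_moment"
proof -
  let ?\<phi> = "normal_density 0 \<sigma>"
  \<comment> \<open>The double angle formula linearises the squared cosine. The resulting frequency
    \<open>t = 4 * pi * x\<close> gives \<open>(\<sigma> * t)\<^sup>2 = 16 * pi\<^sup>2 *
    \<sigma>\<^sup>2 * x\<^sup>2\<close>, and half of it is the exponent in
    \<open>feature_moment\<close>.\<close>
  define g where "g w = 2 * pi\<^sup>2 * (w\<^sup>2 + w\<^sup>2 * cos (4 * pi * x * w))" for w
  have idx: "(1, i, 0) \<in> weight_index L n"
    using assms L by (auto simp: weight_index_def fan_in_def fan_out_def)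
  have "weight_sd L n \<sigma> 1 = \<sigma>"
    by (simp add: weight_sd_def)
  with normal [OF idx] have D: "distributed M lborel (W 1 i 0) ?\<phi>"
    by simp
  have [measurable]: "g \<in> borel_measurable borel"
    unfolding g_def by measurable
  have der_eq: "(der 1 i \<omega>)\<^sup>2 = g (W 1 i 0 \<omega>)" for \<omega>
  proof -
    have double: "1 + cos (4 * pi * x * w) = 2 * (cos (2 * pi * (w * x)))\<^sup>2" for w
      using cos_double_cos [of "2 * pi * (w * x)"] by (simp add: mult_ac)
    have "g w = 2 * pi\<^sup>2 * (w\<^sup>2 * (1 + cos (4 * pi * x * w)))" for w
      by (simp add: g_def distrib_left)
    then have "g w = (2 * pi * cos (2 * pi * (w * x)) * w)\<^sup>2" for w
      unfolding double by (simp add: power_mult_distrib)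
    then show ?thesis
      by (simp add: dense_def fan_in_def activation_deriv_def)
  qed
  have int1: "integrable lborel (\<lambda>w. ?\<phi> w * w\<^sup>2)"
    using integrable_normal_moment [OF sigma, of 0 2] by simp
  have int2: "integrable lborel (\<lambda>w. ?\<phi> w * (w\<^sup>2 * cos (4 * pi * x * w)))"
    using sigma by (intro integrable_normal_density_mult_bounded [where B = 1]) auto
  have eq: "?\<phi> w * g w = 2 * pi\<^sup>2 * (?\<phi> w * w\<^sup>2) + 2 * pi\<^sup>2 * (?\<phi> w * (w\<^sup>2 * cos (4 * pi * x * w)))" for w
    by (simp add: g_def algebra_simps)
  have "integrable lborel (\<lambda>w. ?\<phi> w * g w)"
    unfolding eq using int1 int2 by simp
  then show "integrable M (\<lambda>\<omega>. (der 1 i \<omega>)\<^sup>2)"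
    unfolding der_eq using distributed_integrable [OF D, of g] by simp
  have "expectation (\<lambda>\<omega>. (der 1 i \<omega>)\<^sup>2) = (\<integral>w. ?\<phi> w * g w \<partial>lborel)"
    unfolding der_eq using distributed_integral [OF D, of g] by simp
  also have "\<dots> = 2 * pi\<^sup>2 * (\<integral>w. ?\<phi> w * w\<^sup>2 \<partial>lborel)
      + 2 * pi\<^sup>2 * (\<integral>w. ?\<phi> w * (w\<^sup>2 * cos (4 * pi * x * w)) \<partial>lborel)"
    unfolding eq using int1 int2 by simp
  also have "(\<integral>w. ?\<phi> w * w\<^sup>2 \<partial>lborel) = \<sigma>\<^sup>2"
    using integral_normal_moment_even [OF sigma, of 0 1] by simp
  also have "(\<integral>w. ?\<phi> w * (w\<^sup>2 * cos (4 * pi * x * w)) \<partial>lborel)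
      = \<sigma>\<^sup>2 * (1 - (\<sigma> * (4 * pi * x))\<^sup>2) * exp (- (\<sigma> * (4 * pi * x))\<^sup>2 / 2)"
    by (rule integral_normal_density_square_cos [OF sigma])
  finally show "expectation (\<lambda>\<omega>. (der 1 i \<omega>)\<^sup>2) = feature_moment"
    by (simp add: feature_moment_def power_mult_distrib algebra_simps)
qed

section \<open>Second moments through the dense layers\<close>

text \<open>The vector \<open>der l\<close> is measurable for \<open>history l\<close>, and row
  \<open>i\<close> of layer \<open>Suc l\<close> lies outside \<open>past l\<close>, so the
  combination lemmas apply. Since no activation slope is included, the result serves hidden rows and
  the output row alike.\<close>

lemma dense_der_moments:
  assumes "1 \<le> l" "l < L" "i < fan_out L n (Suc l)"
    and sq: "\<And>j. j < n \<Longrightarrow> integrable M (\<lambda>\<omega>. (der l j \<omega>)\<^sup>2)"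
  defines "D \<equiv> (\<lambda>\<omega>. dense n (\<lambda>i j. W (Suc l) i j \<omega>) (\<lambda>j. der l j \<omega>) i)"
  shows "integrable M D" "expectation D = 0" "integrable M (\<lambda>\<omega>. (D \<omega>)\<^sup>2)"
    "expectation (\<lambda>\<omega>. (D \<omega>)\<^sup>2)
      = (weight_sd L n \<sigma> (Suc l))\<^sup>2 * (\<Sum>j<n. expectation (\<lambda>\<omega>. (der l j \<omega>)\<^sup>2))"
proof -
  let ?X = "\<lambda>(l, i, j). W l i j" and ?e = "\<lambda>j. (Suc l, i, j)"
  have idx: "(Suc l, i, j) \<in> weight_index L n" if "j < n" for j
    using that assms(1-3) by (auto simp: weight_index_def fan_in_def)
  have D_eq: "D = (\<lambda>\<omega>. \<Sum>j<n. ?X (?e j) \<omega> * der l j \<omega>)"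
    by (simp add: D_def dense_def)
  have *: "inj_on ?e {..<n}" "?e ` {..<n} \<subseteq> weight_index L n" "past l \<subseteq> weight_index L n"
    "?e ` {..<n} \<inter> past l = {}"
    using idx by (auto simp: past_def inj_on_def)
  have meas: "der l j \<in> borel_measurable (history l)" if "j < n" for j
    using that assms(1,2) measurable_layer [of l j] by (simp add: fan_in_def)
  note comb = indep finite_lessThan *
  show "integrable M D"
    unfolding D_eq
    by (rule integrable_indep_combination [OF comb, where c = "(weight_sd L n \<sigma> (Suc l))\<^sup>2"])
       (use weight_moments [OF idx] meas sq in auto)
  show "expectation D = 0"
    unfolding D_eq
    by (rule expectation_indep_combination [OF comb, where c = "(weight_sd L n \<sigma> (Suc l))\<^sup>2"])
       (use weight_moments [OF idx] meas sq in auto)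
  show "integrable M (\<lambda>\<omega>. (D \<omega>)\<^sup>2)"
    unfolding D_eq
    by (rule integrable_indep_combination_sq [OF comb, where c = "(weight_sd L n \<sigma> (Suc l))\<^sup>2"])
       (use weight_moments [OF idx] meas sq in auto)
  show "expectation (\<lambda>\<omega>. (D \<omega>)\<^sup>2)
      = (weight_sd L n \<sigma> (Suc l))\<^sup>2 * (\<Sum>j<n. expectation (\<lambda>\<omega>. (der l j \<omega>)\<^sup>2))"
    unfolding D_eq
    by (rule expectation_indep_combination_sq [OF comb])
       (use weight_moments [OF idx] meas sq in auto)
qed

text \<open>The invariant is the expected squared Euclidean norm: each of the \<open>n\<close> rows
  of a hidden layer receives at most the fraction \<open>1 / n\<close> of the previous sum.
  Integrability is carried along because the next layer requires it.\<close>

lemma layer_moment_bound: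
  assumes "1 \<le> l" "l < L"
  shows "(\<forall>i<n. integrable M (\<lambda>\<omega>. (der l i \<omega>)\<^sup>2)) \<and>
    (\<Sum>i<n. expectation (\<lambda>\<omega>. (der l i \<omega>)\<^sup>2)) \<le> n * feature_moment"
  using assms
proof (induction l rule: nat_induct_at_least)
  case base
  then show ?case
    using first_layer_moment by simp
next
  case (Suc l)
  let ?D = "\<lambda>i \<omega>. dense n (\<lambda>i j. W (Suc l) i j \<omega>) (\<lambda>j. der l j \<omega>) i"
  let ?S = "\<Sum>j<n. expectation (\<lambda>\<omega>. (der l j \<omega>)\<^sup>2)"
  have IH: "integrable M (\<lambda>\<omega>. (der l j \<omega>)\<^sup>2)" if "j < n" for j
    using Suc that by simp
  have bound: "?S \<le> n * feature_moment"
    using Suc by simp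
  have "integrable M (\<lambda>\<omega>. (der (Suc l) i \<omega>)\<^sup>2) \<and>
      expectation (\<lambda>\<omega>. (der (Suc l) i \<omega>)\<^sup>2) \<le> 1 / n * ?S" if "i < n" for i
  proof -
    \<comment> \<open>The slope depends on the same weights as \<open>?D i\<close>, so independence
      cannot separate them; the slope is instead bounded by 1 pointwise.\<close>
    have le: "(der (Suc l) i \<omega>)\<^sup>2 \<le> (?D i \<omega>)\<^sup>2" for \<omega>
    proof -
      have "\<bar>der (Suc l) i \<omega>\<bar> \<le> 1 * \<bar>?D i \<omega>\<bar>"
        using Suc.hyps by (simp add: abs_mult fan_in_def)
          (intro mult_left_le_one_le abs_activation_deriv_le_1; simp)
      then show ?thesis by (simp add: abs_le_square_iff)
    qed
    have "i < fan_out L n (Suc l)" "(weight_sd L n \<sigma> (Suc l))\<^sup>2 = 1 / n"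
      using that Suc by (auto simp: fan_out_def weight_sd_def)
    with dense_der_moments(3,4) [OF Suc.hyps _ _ IH, of i] Suc.prems
    have D: "integrable M (\<lambda>\<omega>. (?D i \<omega>)\<^sup>2)" "expectation (\<lambda>\<omega>. (?D i \<omega>)\<^sup>2) = 1 / n * ?S"
      by simp_all
    \<comment> \<open>Integrability by domination also requires measurability with respect to
      \<open>M\<close>, obtained here through the history.\<close>
    have "der (Suc l) i \<in> borel_measurable (history (Suc l))"
      using measurable_layer [of "Suc l" i] that Suc.prems by (simp add: fan_in_def)
    then have "der (Suc l) i \<in> borel_measurable M"
      by (rule measurable_of_generated_by [rotated 2])
         (use indep in \<open>auto simp: indep_vars_def2 past_def\<close>)
    then have int: "integrable M (\<lambda>\<omega>. (der (Suc l) i \<omega>)\<^sup>2)"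
      using le by (intro Bochner_Integration.integrable_bound [OF D(1)] borel_measurable_power)
        (simp_all del: layer_deriv.simps)
    from integral_mono [OF this D(1) le] show ?thesis
      unfolding D(2) using int by blast
  qed
  note step = this
  have "(\<Sum>i<n. expectation (\<lambda>\<omega>. (der (Suc l) i \<omega>)\<^sup>2)) \<le> (\<Sum>i<n. 1 / n * ?S)"
    using step by (intro sum_mono) auto
  also have "\<dots> = ?S"
    using n by simp
  finally show ?case
    using step bound by auto
qed

end

section \<open>Variance at the output layer\<close>

theorem proposition3:
  fixes M :: "'a measure"
    and W :: "nat \<Rightarrow> nat \<Rightarrow> nat \<Rightarrow> 'a \<Rightarrow> real"
    and L n :: nat and \<sigma> x :: real
  assumes "prob_space M"
    and "L \<ge> 2" and "n \<ge> 1" and "\<sigma> > 0"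
    and "prob_space.indep_vars M (\<lambda>_. borel) (\<lambda>(l, i, j). W l i j) (weight_index L n)"
    and "\<And>l i j. (l, i, j) \<in> weight_index L n \<Longrightarrow>
           distributed M lborel (W l i j) (normal_density 0 (weight_sd L n \<sigma> l))"
  shows "let D = (\<lambda>\<omega>. deriv (network L n (\<lambda>l i j. W l i j \<omega>)) x) in
           integrable M D \<and> integrable M (\<lambda>\<omega>. (D \<omega>)\<^sup>2) \<and>
           prob_space.variance M D \<le>
             2 * real n / (real n + 1) * (2 * pi\<^sup>2 * \<sigma>\<^sup>2) *
             (1 + exp (- 8 * pi\<^sup>2 * \<sigma>\<^sup>2 * x\<^sup>2) * (1 - 16 * pi\<^sup>2 * \<sigma>\<^sup>2 * x\<^sup>2))"
proof -
  interpret random_network M W L n \<sigma> x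
    using assms by (simp add: random_network_def random_network_axioms_def)
  \<comment> \<open>The layer feeding the output. For \<open>L = 2\<close> it is the feature layer
    itself, the base case of \<open>layer_moment_bound\<close>.\<close>
  define l where "l = L - 1"
  have l: "1 \<le> l" "l < L" "Suc l = L"
    using L by (auto simp: l_def)
  let ?S = "\<Sum>j<n. expectation (\<lambda>\<omega>. (der l j \<omega>)\<^sup>2)"
  define D where "D = (\<lambda>\<omega>. deriv (network L n (\<lambda>l i j. W l i j \<omega>)) x)"
  have D_eq: "D = (\<lambda>\<omega>. dense n (\<lambda>i j. W (Suc l) i j \<omega>) (\<lambda>j. der l j \<omega>) 0)"
    using l by (auto simp: D_def deriv_network fan_in_def l_def)
  have sq: "integrable M (\<lambda>\<omega>. (der l j \<omega>)\<^sup>2)" if "j < n" for j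
    using layer_moment_bound l that by blast
  have bound: "?S \<le> n * feature_moment"
    using layer_moment_bound l by blast
  have out: "0 < fan_out L n (Suc l)"
    using l by (simp add: fan_out_def)
  note moments = dense_der_moments [OF l(1,2) out sq]
  have int: "integrable M D" "integrable M (\<lambda>\<omega>. (D \<omega>)\<^sup>2)"
    unfolding D_eq using moments(1,3) by simp_all
  \<comment> \<open>With mean zero the variance is the second moment, so the bound on the latter
    suffices.\<close>
  have mean: "expectation D = 0"
    unfolding D_eq using moments(2) by simp
  have "(weight_sd L n \<sigma> (Suc l))\<^sup>2 = 2 / (real n + 1)"
    using l by (auto simp: weight_sd_def)
  then have "expectation (\<lambda>\<omega>. (D \<omega>)\<^sup>2) = 2 / (real n + 1) * ?S"
    unfolding D_eq using moments(4) by simp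
  also have "\<dots> \<le> 2 / (real n + 1) * (n * feature_moment)"
    using bound by (intro mult_left_mono) auto
  finally have "variance D \<le> 2 * real n / (real n + 1) * feature_moment"
    using mean by simp
  with int show ?thesis
    unfolding Let_def D_def [symmetric] feature_moment_def by (simp only: mult.assoc simp_thms)
qed

end
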